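(* For every integer $n\geq 1$, the Bernoulli-Fibonacci polynomials satisfy $$\sum_{l=0}^{n-1} {n \brack l}_F\, B_l^F(x) = F_n\, x^{n-1}.$$
   Context: Let $F_n$ be the Fibonacci numbers ($F_0=0$, $F_1=F_2=1$, $F_{n+1}=F_n+F_{n-1}$). The Fibonacci factorial is $F_n! = F_1F_2\cdots F_n$ for $n\ge 1$, with $F_0! = 1$. The Fibonomial coefficients are ${n \brack k}_F = \frac{F_n!}{F_{n-k}!\,F_k!}$ for integers $n\geq k\geq 0$. The Golden exponential function is $e_F^x = \sum_{n=0}^\infty \frac{x^n}{F_n!}$ (written $e_F^{zx}$ when evaluated at $zx$). The Bernoulli-Fibonacci polynomials $B_n^F(x)$, $n\geq 0$, are defined by the generating function (power series in $z$) $$\frac{z\, e_F^{zx}}{e_F^{z}-1} = \sum_{n=0}^\infty B_n^F(x)\frac{z^n}{F_n!}.$$ *)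

theory Defs
  imports "HOL-Number_Theory.Fib" "HOL-Computational_Algebra.Polynomial_FPS"
begin

definition fib_fact :: "nat \<Rightarrow> nat" where
  "fib_fact n = (\<Prod>k=1..n. fib k)"

text \<open>Meaningful for \<open>k \<le> n\<close> only.\<close>

definition fibonomial :: "nat \<Rightarrow> nat \<Rightarrow> 'a::field_char_0" where
  "fibonomial n k = of_nat (fib_fact n) / (of_nat (fib_fact (n - k)) * of_nat (fib_fact k))"

text \<open>The golden exponential \<open>e\<^sub>F\<close> evaluated at \<open>c z\<close>, as a formal power series in \<open>z\<close>
  (the analogue of \<^const>\<open>fps_exp\<close>).\<close>

definition golden_exp :: "'a::field_char_0 \<Rightarrow> 'a fps" where
  "golden_exp c = Abs_fps (\<lambda>n. c ^ n / of_nat (fib_fact n))"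

text \<open>The values of the Bernoulli-Fibonacci polynomials, read off from their generating function.
  Both numerator and denominator have zero constant term; the lemmas below show that the
  formal quotient is the genuine one and that the values are polynomial in \<open>x\<close>.\<close>

definition bernoulli_fib :: "nat \<Rightarrow> 'a::field_char_0 \<Rightarrow> 'a" where
  "bernoulli_fib n x =
     of_nat (fib_fact n) * fps_nth (fps_X * golden_exp x / (golden_exp 1 - 1)) n"

lemma fib_fact_pos: "fib_fact n > 0"
  unfolding fib_fact_def by (auto intro!: prod_pos simp: fib_neq_0_nat)

lemma golden_exp_minus_1_nth:
  "fps_nth (golden_exp 1 - 1 :: 'a::field_char_0 fps) 0 = 0"
  "fps_nth (golden_exp 1 - 1 :: 'a::field_char_0 fps) 1 = 1"
  by (simp_all add: golden_exp_def fib_fact_def)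

lemma subdegree_golden_exp_minus_1:
  "subdegree (golden_exp 1 - 1 :: 'a::field_char_0 fps) = 1"
  by (rule subdegreeI) (simp_all add: golden_exp_def fib_fact_def)

lemma golden_exp_minus_1_nonzero: "golden_exp 1 - 1 \<noteq> (0 :: 'a::field_char_0 fps)"
  using subdegree_golden_exp_minus_1[where 'a = 'a] by force

lemma golden_exp_minus_1_dvd_fps_X: "golden_exp 1 - 1 dvd (fps_X :: 'a::field_char_0 fps)"
  using golden_exp_minus_1_nonzero[where 'a = 'a] subdegree_golden_exp_minus_1[where 'a = 'a]
  by (subst fps_dvd_iff) auto

lemma bernoulli_fib_gf:
  "fps_X * golden_exp x / (golden_exp 1 - 1) =
     Abs_fps (\<lambda>n. bernoulli_fib n x / of_nat (fib_fact n))"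
  using fib_fact_pos by (auto simp: fps_eq_iff bernoulli_fib_def dest: less_imp_neq)

lemma bernoulli_fib_gf_mult:
  "Abs_fps (\<lambda>n. bernoulli_fib n x / of_nat (fib_fact n)) * (golden_exp 1 - 1) =
     fps_X * golden_exp x"
  unfolding bernoulli_fib_gf [symmetric]
  by (intro dvd_div_mult_self dvd_mult2 golden_exp_minus_1_dvd_fps_X)

lemma bernoulli_fib_polynomial:
  "\<exists>p :: 'a::field_char_0 poly. \<forall>x. poly p x = bernoulli_fib n x"
proof -
  define b where "b = (fps_X :: 'a fps) / (golden_exp 1 - 1)"
  define p where "p = (\<Sum>i=0..n. monom (of_nat (fib_fact n) * fps_nth b (n - i)
                                          / of_nat (fib_fact i)) i)"
  have "poly p x = bernoulli_fib n x" for x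
  proof -
    have "fps_X * golden_exp x / (golden_exp 1 - 1) = golden_exp x * b"
      unfolding b_def
      by (metis div_mult_swap golden_exp_minus_1_dvd_fps_X mult.commute)
    then have "bernoulli_fib n x =
        of_nat (fib_fact n) * (\<Sum>i=0..n. fps_nth (golden_exp x) i * fps_nth b (n - i))"
      by (simp only: bernoulli_fib_def fps_mult_nth)
    then show ?thesis
      by (simp add: p_def golden_exp_def poly_sum poly_monom sum_distrib_left mult_ac)
  qed
  then show ?thesis by blast
qed

end

theory Submission
  imports Defs
begin

text \<open>
  Clearing the denominator in the generating function turns it into the identity
  \<open>(\<Sum>l. B\<^sub>l(x) z\<^sup>l / F\<^sub>l!) (e\<^sub>F(z) - 1) = z e\<^sub>F(z x)\<close> of formal power series, and the proposition is
  the comparison of the coefficients of \<open>z\<^sup>n\<close>, multiplied by \<open>F\<^sub>n!\<close>. On the left the factor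
  \<open>e\<^sub>F(z) - 1\<close> has no constant term, which is what removes \<open>l = n\<close> from the convolution, while the
  factorials of the other terms assemble into Fibonomial coefficients. On the right the factor
  \<open>z\<close> shifts the exponential, and \<open>F\<^sub>n! = F\<^sub>n F\<^sub>n\<^sub>-\<^sub>1!\<close> leaves the factor \<open>F\<^sub>n\<close>.
\<close>

lemma fib_fact_Suc: "fib_fact (Suc m) = fib (Suc m) * fib_fact m"
  by (simp add: fib_fact_def mult.commute)

lemma golden_exp_minus_1_nth_pos:
  assumes "k > 0"
  shows "fps_nth (golden_exp 1 - 1 :: 'a::field_char_0 fps) k = 1 / of_nat (fib_fact k)"
  using assms by (simp add: golden_exp_def)

theorem proposition4p0p6:
  fixes n :: nat and x :: "'a::field_char_0"
  assumes "n \<ge> 1"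
  shows "(\<Sum>l=0..n-1. fibonomial n l * bernoulli_fib l x) = of_nat (fib n) * x ^ (n - 1)"
proof -
  obtain m where n: "n = Suc m"
    using assms by (cases n) auto
  define b where "b = (\<lambda>l. bernoulli_fib l x / of_nat (fib_fact l))"
  have "(\<Sum>l=0..m. b l / of_nat (fib_fact (n - l))) =
          (\<Sum>l=0..m. b l * fps_nth (golden_exp 1 - 1) (n - l))"
    by (intro sum.cong refl) (simp add: golden_exp_minus_1_nth_pos n del: fps_sub_nth)
  also have "\<dots> = (\<Sum>l=0..n. b l * fps_nth (golden_exp 1 - 1) (n - l))"
    by (simp add: n golden_exp_minus_1_nth(1) del: fps_sub_nth)
  also have "\<dots> = fps_nth (Abs_fps b * (golden_exp 1 - 1)) n"
    by (simp add: fps_mult_nth del: fps_sub_nth)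
  also have "\<dots> = fps_nth (fps_X * golden_exp x) n"
    by (simp only: b_def bernoulli_fib_gf_mult)
  also have "\<dots> = x ^ m / of_nat (fib_fact m)"
    by (simp add: n golden_exp_def)
  finally have coeff: "(\<Sum>l=0..m. b l / of_nat (fib_fact (n - l))) = x ^ m / of_nat (fib_fact m)" .
  have "(\<Sum>l=0..n-1. fibonomial n l * bernoulli_fib l x) =
          of_nat (fib_fact n) * (\<Sum>l=0..m. b l / of_nat (fib_fact (n - l)))"
    by (simp add: n fibonomial_def b_def sum_distrib_left mult_ac)
  also have "\<dots> = of_nat (fib_fact n) * (x ^ m / of_nat (fib_fact m))"
    by (simp only: coeff)
  also have "\<dots> = of_nat (fib n) * x ^ (n - 1)"
    using fib_fact_pos[of m] by (simp add: n fib_fact_Suc del: fib.simps)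
  finally show ?thesis .
qed

end
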